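(* Let $\mathbf{R},\mathbf{A}+\mathbf{R}\in\mathbb{F}_q^{r\times\ell}$ be two shares generated from the private matrix $\mathbf{A}\in\mathbb{F}_q^{r\times \ell}$ as described in the context, with average sparsity $s_{\mathrm{avg}}$. Let $n$ be an even positive integer (number of storage nodes) dividing $r$, and let $\xi\in\{0,\dots,\frac n2-1\}$. Split $\mathbf{R}$ and $\mathbf{A}+\mathbf{R}$ row-wise into $n$ sub-shares $\mathbf{R}_0,\dots,\mathbf{R}_{n-1}$ and $(\mathbf{A}+\mathbf{R})_0,\dots,(\mathbf{A}+\mathbf{R})_{n-1}$, each of size $\frac rn\times\ell$, and let node $i\in\{0,\dots,n-1\}$ store the sub-shares $$\mathcal{W}_i^{\mathbf{A}+\mathbf{R}}=\{(\mathbf{A}+\mathbf{R})_{i+j \bmod n}\}_{j=0}^{\xi},\qquad \mathcal{W}_i^{\mathbf{R}}=\{\mathbf{R}_{n/2+i+j \bmod n}\}_{j=0}^{\xi}.$$ Then this is an $(n,n-\xi,1)$ sparse secret sharing scheme with information leakage $\frac{(\xi+1)(\mathrm{L}_1+\mathrm{L}_2)}{n}$, that is: (i) the contents of any $n-\xi$ nodes suffice to reconstruct $\mathbf{A}$; (ii) for every node $i$, the mutual information (base $q$) between $\mathbf{A}$ and the content $(\mathcal{W}_i^{\mathbf{A}+\mathbf{R}},\mathcal{W}_i^{\mathbf{R}})$ of node $i$ equals $\frac{(\xi+1)(\mathrm{L}_1+\mathrm{L}_2)}{n}$; (iii) the average storage cost $\mathbb{E}[C_{\mathrm{sparse}}]$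 (expected number of bits stored per node) is bounded from above by $$(2\xi+2)(1-s_{\mathrm{avg}})\frac{r\ell}{n}\left(\lceil\log_2 q\rceil+\left\lceil\log_2\left(\frac{r\ell}{n}\right)\right\rceil\right).$$ Moreover, (iv) the average storage cost of this scheme is smaller than that of a non-sparse $(n,n-\xi,1)$ secret sharing scheme, $\mathbb{E}[C_{\mathrm{sparse}}]<C_{\mathrm{classical}}=\frac{r\ell}{n-\xi-1}\lceil\log_2 q\rceil$, whenever $$s_{\mathrm{avg}}>1-\frac{1}{2(\xi+1)}\cdot\frac{n}{n-\xi-1}\cdot\frac{\log_2 q}{\log_2 q+\lceil\log_2(r\ell/n)\rceil}.$$
   Context: $\mathbb{F}_q$ is the finite field with $q\ge3$ elements and $\mathbb{F}_q^*=\mathbb{F}_q\setminus\{0\}$. The private matrix $\mathbf{A}\in\mathbb{F}_q^{r\times\ell}$ has i.i.d. entries, each equal to $0$ with probability $s$ ($q^{-1}<s<1$) and equal to each $a\in\mathbb{F}_q^*$ with probability $\frac{1-s}{q-1}$. The padding matrix $\mathbf{R}\in\mathbb{F}_q^{r\times\ell}$ is generated entrywise: the pairs of entries $(\mathbf{A}_{\{u,v\}},\mathbf{R}_{\{u,v\}})$ are i.i.d. over $(u,v)$, with $$\Pr(\mathbf{R}_{\{u,v\}}=x\mid \mathbf{A}_{\{u,v\}}=0)=\begin{cases}p_1,&x=0\\ p_1^{\mathrm{inv}},&x\neq0,\end{cases}$$ and, for $a\in\mathbb{F}_q^*$, $$\Pr(\mathbf{R}_{\{u,v\}}=x\mid \mathbf{A}_{\{u,v\}}=a)=\begin{cases}p_2,&x=0\\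 p_3,&x=-a\\ p_{2,3}^{\mathrm{inv}},&x\notin\{0,-a\},\end{cases}$$ where all of $p_1,p_2,p_3$, $p_1^{\mathrm{inv}}=(1-p_1)/(q-1)$ and $p_{2,3}^{\mathrm{inv}}=(1-p_2-p_3)/(q-2)$ lie in $[0,1]$. The two shares are $\mathbf{R}$ and $\mathbf{A}+\mathbf{R}$. The sparsity levels are $s_R=\Pr(\mathbf{R}_{\{u,v\}}=0)$ and $s_{A+R}=\Pr(\mathbf{A}_{\{u,v\}}+\mathbf{R}_{\{u,v\}}=0)$, and $s_{\mathrm{avg}}=\frac{s_R+s_{A+R}}{2}$. The leakages of the shares are $\mathrm{L}_1=\mathrm{I}_q(\mathbf{A};\mathbf{R})$ and $\mathrm{L}_2=\mathrm{I}_q(\mathbf{A};\mathbf{A}+\mathbf{R})$, mutual informations (base-$q$ logarithms) between the whole random matrices. Terminology: an $(n,k,z)$ sparse secret sharing scheme stores data on $n$ nodes so that any $k$ nodes suffice to reconstruct the secret, and its information leakage is the mutual information between the secret and the content of any $z$ nodes. Storage cost: each sub-share is stored by recording, for each of its non-zero entries only, the value using $\lceil\log_2 q\rceil$ bits and the position (an index among the $r\ell/n$ entries of the sub-share) using $\lceil\log_2(r\ell/n)\rceil$ bits; $C_{\mathrm{sparse}}$ is the total number of bits so stored at a node. The storage cost per node of a classical (non-sparse) $(n,n-\xi,1)$ secret sharing scheme is taken to be $C_{\mathrm{classical}}=\frac{r\ell}{n-\xi-1}\lceil\log_2 q\rceil$ bits. *)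

theory Defs
  imports "HOL-Probability.Information" "Jordan_Normal_Form.Matrix"
begin

hide_const (open) Finite_Cartesian_Product.mat Finite_Cartesian_Product.vec

text \<open>
  Mutual information of two random variables with finite range. This is the library notation
  \<open>\<I>(X ; Y)\<close>, stated outside its locale so that the base \<open>b\<close> of the logarithm is explicit.
\<close>

definition mutual_info :: "'w measure \<Rightarrow> real \<Rightarrow> ('w \<Rightarrow> 'b) \<Rightarrow> ('w \<Rightarrow> 'c) \<Rightarrow> real" where
  "mutual_info M b X Y =
     prob_space.mutual_information M b (count_space (X ` space M)) (count_space (Y ` space M)) X Y"

text \<open>
  The assumptions \<open>A_zero\<close>, \<open>A_nonzero\<close>, \<open>R_given_zero\<close> and \<open>R_given_nonzero\<close> fix the joint law of
  the pair of entries at each position, so that together with the independence assumption the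
  pairs are independent and identically distributed.
\<close>

locale sparse_shares = prob_space M
  for M :: "'w measure" +
  fixes q r l :: nat
    and s p1 p2 p3 p1_inv p23_inv :: real
    and A R :: "'w \<Rightarrow> 'f :: {field, finite} mat"
  assumes card_field: "CARD('f) = q" and q_ge_3: "q \<ge> 3"
    and r_pos: "r > 0" and l_pos: "l > 0"
    and s_bounds: "1 / real q < s" "s < 1"
    and p1_inv: "p1_inv = (1 - p1) / (real q - 1)"
    and p23_inv: "p23_inv = (1 - p2 - p3) / (real q - 2)"
    and p_bounds: "p1 \<in> {0..1}" "p2 \<in> {0..1}" "p3 \<in> {0..1}" "p1_inv \<in> {0..1}" "p23_inv \<in> {0..1}"
    and A_carrier: "\<And>\<omega>. \<omega> \<in> space M \<Longrightarrow> A \<omega> \<in> carrier_mat r l"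
    and R_carrier: "\<And>\<omega>. \<omega> \<in> space M \<Longrightarrow> R \<omega> \<in> carrier_mat r l"
    and indep_entries:
      "indep_vars (\<lambda>_. count_space UNIV) (\<lambda>uv \<omega>. (A \<omega> $$ uv, R \<omega> $$ uv)) ({..<r} \<times> {..<l})"
    and A_zero: "\<And>u v. u < r \<Longrightarrow> v < l \<Longrightarrow> \<P>(\<omega> in M. A \<omega> $$ (u, v) = 0) = s"
    and A_nonzero: "\<And>u v a. u < r \<Longrightarrow> v < l \<Longrightarrow> a \<noteq> 0 \<Longrightarrow>
      \<P>(\<omega> in M. A \<omega> $$ (u, v) = a) = (1 - s) / (real q - 1)"
    and R_given_zero: "\<And>u v x. u < r \<Longrightarrow> v < l \<Longrightarrow>
      \<P>(\<omega> in M. R \<omega> $$ (u, v) = x \<bar> A \<omega> $$ (u, v) = 0) = (if x = 0 then p1 else p1_inv)"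
    and R_given_nonzero: "\<And>u v a x. u < r \<Longrightarrow> v < l \<Longrightarrow> a \<noteq> 0 \<Longrightarrow>
      \<P>(\<omega> in M. R \<omega> $$ (u, v) = x \<bar> A \<omega> $$ (u, v) = a) =
        (if x = 0 then p2 else if x = - a then p3 else p23_inv)"

definition sub_share :: "nat \<Rightarrow> 'a mat \<Rightarrow> nat \<Rightarrow> 'a mat" where
  "sub_share n X m =
     Matrix.mat (dim_row X div n) (dim_col X) (\<lambda>(u, v). X $$ (m * (dim_row X div n) + u, v))"

text \<open>
  The content of a node is an indexed family of sub-shares rather than a bare set of matrices:
  the node knows which sub-share each of its matrices is. The two components are the sub-shares
  of the padded matrix \<open>A + R\<close> and those of the padding matrix \<open>R\<close>.
\<close>

definition node_content ::
  "nat \<Rightarrow> nat \<Rightarrow> 'a mat \<Rightarrow> 'a mat \<Rightarrow> nat \<Rightarrow> 'a mat list \<times> 'a mat list" where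
  "node_content n \<xi> B R i =
     (map (\<lambda>j. sub_share n B ((i + j) mod n)) [0..<\<xi> + 1],
      map (\<lambda>j. sub_share n R ((n div 2 + i + j) mod n)) [0..<\<xi> + 1])"

definition nnz :: "'a :: zero mat \<Rightarrow> nat" where
  "nnz X = card {(u, v). u < dim_row X \<and> v < dim_col X \<and> X $$ (u, v) \<noteq> 0}"

text \<open>
  Each non-zero entry is stored as its field value together with its index among all entries of
  the matrix; zero entries cost nothing.
\<close>

definition sparse_bits :: "'f :: {field, finite} mat \<Rightarrow> real" where
  "sparse_bits X = real (nnz X) *
     (real_of_int \<lceil>log 2 (real CARD('f))\<rceil> + real_of_int \<lceil>log 2 (real (dim_row X * dim_col X))\<rceil>)"

definition node_bits :: "'f :: {field, finite} mat list \<times> 'f mat list \<Rightarrow> real" where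
  "node_bits W = (\<Sum>X\<leftarrow>fst W. sparse_bits X) + (\<Sum>X\<leftarrow>snd W. sparse_bits X)"

end

theory Submission
  imports Defs
begin

text \<open>
  The mutual information of finite random variables is the mean of the information density, and
  the density is additive over independent pairs. A node holds the windows of \<open>A + R\<close> and \<open>R\<close> that
  are half a cycle apart; as \<open>\<xi> + 1 \<le> n div 2\<close> they occupy disjoint cells, so no cell contributes
  both of its shares. Each occupied cell therefore leaks exactly the per-entry information of one
  share, and the remaining cells leak nothing.
\<close>

section \<open>Mutual information of independent families\<close>

text \<open>Matrices and lists of matrices form infinite types, while entries range over a finite
  field. Matrices and node contents are therefore handled through their level sets: two sample
  points are compared, and equality of what is observed becomes equality of entries on a set of
  cells. This one form serves for measurability, for the information density and for decodability.
  Independence alone would leave a different leakage at each cell. The hypotheses also fix the joint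
  law of the entry pair, the same at every position, so each cell can be traded for the cell
  \<open>(0, 0)\<close>. A whole share then leaks \<open>r * l\<close> times a per-entry value, and
  the factor (\<xi> + 1) / n is the fraction of cells that one window occupies. In the cost
  comparison the threshold contains log 2 q while both costs contain its ceiling; the gap is closed
  by monotonicity of x / (x + c).\<close>

lemma simple_function_factor:
  assumes T: "simple_function M T"
    and fac: "\<And>\<omega> \<omega>'. \<omega> \<in> space M \<Longrightarrow> \<omega>' \<in> space M \<Longrightarrow> T \<omega> = T \<omega>' \<Longrightarrow> U \<omega> = U \<omega>'"
  shows "simple_function M U"
proof -
  \<comment> \<open>Evaluating \<open>U\<close> at any sample point of the level set
    \<open>T = t\<close> gives the same value by \<open>fac\<close>; outside the range of
    \<open>T\<close> the value is arbitrary.\<close>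
  define g where "g t = U (SOME \<omega>. \<omega> \<in> space M \<and> T \<omega> = t)" for t
  have "U \<omega> = g (T \<omega>)" if "\<omega> \<in> space M" for \<omega>
  proof -
    have "\<exists>\<omega>'. \<omega>' \<in> space M \<and> T \<omega>' = T \<omega>" using that by blast
    from someI_ex[OF this] show ?thesis
      unfolding g_def using fac that by metis
  qed
  then have "simple_function M U \<longleftrightarrow> simple_function M (\<lambda>\<omega>. g (T \<omega>))"
    by (rule simple_function_cong)
  with simple_function_compose1[OF T] show ?thesis by blast
qed

text \<open>A function determined by finitely many simple functions factors through their tuple,
  which has finite range. This covers matrices and node contents, which are determined by their
  entries.\<close>

lemma simple_function_family:
  assumes "finite K" and X: "\<And>k. k \<in> K \<Longrightarrow> simple_function M (X k)"
    and fac: "\<And>\<omega> \<omega>'. \<omega> \<in> space M \<Longrightarrow> \<omega>' \<in> space M \<Longrightarrow>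
      (\<And>k. k \<in> K \<Longrightarrow> X k \<omega> = X k \<omega>') \<Longrightarrow> U \<omega> = U \<omega>'"
  shows "simple_function M U"
proof -
  have "simple_function M (\<lambda>\<omega>. \<lambda>k\<in>K. X k \<omega>)"
    using \<open>finite K\<close> X
  proof (induction K)
    case empty
    show ?case by (simp add: restrict_def)
  next
    case (insert k K)
    then have "simple_function M (\<lambda>\<omega>. (X k \<omega>, \<lambda>j\<in>K. X j \<omega>))"
      by (intro simple_function_Pair) blast+
    then show ?case
    proof (rule simple_function_factor)
      fix \<omega> \<omega>' assume eq: "(X k \<omega>, \<lambda>j\<in>K. X j \<omega>) = (X k \<omega>', \<lambda>j\<in>K. X j \<omega>')"
      then have "X j \<omega> = X j \<omega>'" if "j \<in> K" for j
        using that by (metis prod.inject restrict_apply')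
      with eq show "(\<lambda>j\<in>insert k K. X j \<omega>) = (\<lambda>j\<in>insert k K. X j \<omega>')"
        by (intro restrict_ext) auto
    qed
  qed
  then show ?thesis
  proof (rule simple_function_factor)
    fix \<omega> \<omega>' assume "\<omega> \<in> space M" "\<omega>' \<in> space M" "(\<lambda>k\<in>K. X k \<omega>) = (\<lambda>k\<in>K. X k \<omega>')"
    then show "U \<omega> = U \<omega>'" by (intro fac) (metis restrict_apply')+
  qed
qed

lemma simple_function_sets:
  assumes "simple_function M Z"
  shows "{\<omega> \<in> space M. P (Z \<omega>)} \<in> sets M"
proof -
  have "{\<omega> \<in> space M. P (Z \<omega>)} = Z -` {z. P z} \<inter> space M" by auto
  with assms show ?thesis using simple_functionD(2) by metis
qed

context prob_space
begin

lemma expectation_simple: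
  fixes f :: "'b \<Rightarrow> real"
  assumes Z: "simple_function M Z" and S: "finite S" "Z ` space M \<subseteq> S"
  shows "expectation (\<lambda>\<omega>. f (Z \<omega>)) = (\<Sum>z\<in>S. \<P>(\<omega> in M. Z \<omega> = z) * f z)"
    and "integrable M (\<lambda>\<omega>. f (Z \<omega>))"
proof -
  let ?g = "\<lambda>\<omega>. \<Sum>z\<in>S. f z * indicator {\<omega> \<in> space M. Z \<omega> = z} \<omega>"
  have eq: "f (Z \<omega>) = ?g \<omega>" if "\<omega> \<in> space M" for \<omega>
  proof -
    have "?g \<omega> = (\<Sum>z\<in>S. if z = Z \<omega> then f z else 0)"
      using that by (intro sum.cong) (auto simp: indicator_def)
    then show ?thesis using S that by (simp add: sum.delta' image_subset_iff)
  qed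
  have m: "{\<omega> \<in> space M. Z \<omega> = z} \<in> sets M" for z
    using simple_function_sets[OF Z] .
  have "integrable M ?g"
    using m by (auto simp: emeasure_eq_measure)
  then show "integrable M (\<lambda>\<omega>. f (Z \<omega>))"
    by (rule Bochner_Integration.integrable_cong[THEN iffD2, rotated 2]) (simp_all add: eq)
  have "expectation (\<lambda>\<omega>. f (Z \<omega>)) = expectation ?g"
    by (intro Bochner_Integration.integral_cong) (simp_all add: eq)
  also have "\<dots> = (\<Sum>z\<in>S. f z * \<P>(\<omega> in M. Z \<omega> = z))"
    using m by (subst Bochner_Integration.integral_sum) (auto simp: emeasure_eq_measure sets.Int_space_eq2)
  finally show "expectation (\<lambda>\<omega>. f (Z \<omega>)) = (\<Sum>z\<in>S. \<P>(\<omega> in M. Z \<omega> = z) * f z)"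
    by (simp add: mult.commute)
qed

text \<open>The level sets of probability 0 are finitely many, so together they are null. This
  supplies the strict positivity under which the logarithm of a product splits.\<close>

lemma AE_atom_pos:
  assumes Z: "simple_function M Z"
  shows "AE \<omega> in M. \<P>(\<omega>' in M. Z \<omega>' = Z \<omega>) > 0"
proof -
  have "AE \<omega> in M. \<forall>z\<in>Z ` space M. \<P>(\<omega>' in M. Z \<omega>' = z) = 0 \<longrightarrow> Z \<omega> \<noteq> z"
  proof (rule AE_finite_allI)
    show "finite (Z ` space M)" using Z by (rule simple_functionD)
    fix z
    show "AE \<omega> in M. \<P>(\<omega>' in M. Z \<omega>' = z) = 0 \<longrightarrow> Z \<omega> \<noteq> z"
    proof (cases "\<P>(\<omega>' in M. Z \<omega>' = z) = 0")
      case True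
      then show ?thesis
        using prob_eq_0[OF simple_function_sets[OF Z, of "\<lambda>x. x = z"]] by auto
    qed simp
  qed
  with AE_space show ?thesis
    by eventually_elim (auto simp: zero_less_measure_iff)
qed

text \<open>
  The information density, whose mean is the mutual information. It sees \<open>U\<close> and \<open>V\<close> only
  through their level sets, and it is additive over independent families.
\<close>

definition info_density :: "real \<Rightarrow> ('a \<Rightarrow> 'b) \<Rightarrow> ('a \<Rightarrow> 'c) \<Rightarrow> 'a \<Rightarrow> real" where
  "info_density b U V \<omega> =
     log b (\<P>(\<omega>' in M. U \<omega>' = U \<omega> \<and> V \<omega>' = V \<omega>) /
       (\<P>(\<omega>' in M. U \<omega>' = U \<omega>) * \<P>(\<omega>' in M. V \<omega>' = V \<omega>)))"

text \<open>\<open>S\<close> may exceed the joint range, since values that are not attained carry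
  probability 0. With finite value types \<open>S\<close> can thus be \<open>UNIV\<close>, a common
  index set for variables whose ranges differ.\<close>

lemma info_density_sum:
  fixes b :: real
  assumes U: "simple_function M U" and V: "simple_function M V"
    and S: "finite S" "(\<lambda>\<omega>. (U \<omega>, V \<omega>)) ` space M \<subseteq> S"
  shows "expectation (info_density b U V) =
      (\<Sum>(u, v)\<in>S. \<P>(\<omega> in M. U \<omega> = u \<and> V \<omega> = v) *
         log b (\<P>(\<omega> in M. U \<omega> = u \<and> V \<omega> = v) / (\<P>(\<omega> in M. U \<omega> = u) * \<P>(\<omega> in M. V \<omega> = v))))"
    and "integrable M (info_density b U V)"
proof -
  have Z: "simple_function M (\<lambda>\<omega>. (U \<omega>, V \<omega>))" using U V by auto
  define f where "f = (\<lambda>(u, v). log b (\<P>(\<omega> in M. U \<omega> = u \<and> V \<omega> = v) /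
    (\<P>(\<omega> in M. U \<omega> = u) * \<P>(\<omega> in M. V \<omega> = v))))"
  have eq: "info_density b U V = (\<lambda>\<omega>. f (U \<omega>, V \<omega>))"
    by (simp add: f_def info_density_def fun_eq_iff)
  show "integrable M (info_density b U V)"
    unfolding eq by (rule expectation_simple[OF Z S])
  show "expectation (info_density b U V) =
      (\<Sum>(u, v)\<in>S. \<P>(\<omega> in M. U \<omega> = u \<and> V \<omega> = v) *
         log b (\<P>(\<omega> in M. U \<omega> = u \<and> V \<omega> = v) / (\<P>(\<omega> in M. U \<omega> = u) * \<P>(\<omega> in M. V \<omega> = v))))"
    unfolding eq expectation_simple(1)[OF Z S] by (simp add: f_def case_prod_unfold prod_eq_iff)
qed

text \<open>The sum over the joint range depends on the types of the values; as an integral over the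
  sample space, the same quantity can be compared pointwise with the densities of single
  cells.\<close>

lemma mutual_info_eq_expectation:
  assumes b: "b > 1" and U: "simple_function M U" and V: "simple_function M V"
  shows "mutual_info M b U V = expectation (info_density b U V)"
proof -
  interpret information_space M b by standard (rule b)
  have Z: "simple_function M (\<lambda>\<omega>. (U \<omega>, V \<omega>))" using U V by auto
  note sd = simple_distributedI[OF _ measure_nonneg refl]
  have "mutual_info M b U V = (\<Sum>(u, v)\<in>(\<lambda>\<omega>. (U \<omega>, V \<omega>)) ` space M.
    prob ((\<lambda>\<omega>. (U \<omega>, V \<omega>)) -` {(u, v)} \<inter> space M) *
      log b (prob ((\<lambda>\<omega>. (U \<omega>, V \<omega>)) -` {(u, v)} \<inter> space M) /
        (prob (U -` {u} \<inter> space M) * prob (V -` {v} \<inter> space M))))"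
    unfolding mutual_info_def
    by (rule mutual_information_simple_distributed[OF sd[OF U] sd[OF V] sd[OF Z]])
  also have "\<dots> = expectation (info_density b U V)"
    unfolding info_density_sum(1)[OF U V simple_functionD(1)[OF Z] order.refl]
    by (intro sum.cong) (auto simp: vimage_def Int_def conj_commute)
  finally show ?thesis .
qed

lemma mutual_info_const:
  assumes b: "b > 1" and U: "simple_function M U"
  shows "mutual_info M b U (\<lambda>_. c) = 0"
proof -
  have "info_density b U (\<lambda>_. c) = (\<lambda>_. 0)"
  proof
    fix \<omega>
    show "info_density b U (\<lambda>_. c) \<omega> = 0"
      \<comment> \<open>On a null level set the ratio is 0 / 0 = 0, and the logarithm of 0 is 0 by
        convention; on any other the ratio is 1.\<close>
      by (cases "\<P>(\<omega>' in M. U \<omega>' = U \<omega>) = 0") (simp_all add: info_density_def prob_space log_def)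
  qed
  then show ?thesis by (simp add: mutual_info_eq_expectation[OF b U])
qed

lemma prob_law_pred:
  fixes Z :: "'a \<Rightarrow> 'b :: finite"
  assumes "simple_function M Z"
  shows "\<P>(\<omega> in M. P (Z \<omega>)) = (\<Sum>z | P z. \<P>(\<omega> in M. Z \<omega> = z))"
proof -
  have "{\<omega> \<in> space M. P (Z \<omega>)} = (\<Union>z\<in>{z. P z}. {\<omega> \<in> space M. Z \<omega> = z})" by auto
  then show ?thesis
    using simple_function_sets[OF assms, of "\<lambda>x. x = z" for z]
    by (simp only:, intro finite_measure_finite_Union) (auto simp: disjoint_family_on_def)
qed

text \<open>The joint law determines both marginals by summation, so the two sums over
  \<open>UNIV\<close> agree term by term. It moves the leakage of any cell to a reference
  cell.\<close>

lemma mutual_info_cong_law: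
  fixes X X' :: "'a \<Rightarrow> 'b :: finite" and Y Y' :: "'a \<Rightarrow> 'c :: finite"
  assumes b: "b > 1"
    and X: "simple_function M X" "simple_function M X'"
    and Y: "simple_function M Y" "simple_function M Y'"
    and law: "\<And>x y. \<P>(\<omega> in M. X \<omega> = x \<and> Y \<omega> = y) = \<P>(\<omega> in M. X' \<omega> = x \<and> Y' \<omega> = y)"
  shows "mutual_info M b X Y = mutual_info M b X' Y'"
proof -
  have Z: "simple_function M (\<lambda>\<omega>. (X \<omega>, Y \<omega>))" "simple_function M (\<lambda>\<omega>. (X' \<omega>, Y' \<omega>))"
    using X Y by auto
  have "\<P>(\<omega> in M. X \<omega> = x) = \<P>(\<omega> in M. X' \<omega> = x)" for x
    using Z[THEN prob_law_pred, of "\<lambda>z. fst z = x"] law by (simp add: prod_eq_iff)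
  moreover have "\<P>(\<omega> in M. Y \<omega> = y) = \<P>(\<omega> in M. Y' \<omega> = y)" for y
    using Z[THEN prob_law_pred, of "\<lambda>z. snd z = y"] law by (simp add: prod_eq_iff)
  ultimately show ?thesis
    using info_density_sum(1)[OF X(1) Y(1), of UNIV b] info_density_sum(1)[OF X(2) Y(2), of UNIV b]
    by (simp add: mutual_info_eq_expectation[OF b] X Y law)
qed

lemma prob_indep_family:
  assumes "indep_vars (\<lambda>_. count_space UNIV) Z K" "finite K"
  shows "\<P>(\<omega> in M. \<forall>k\<in>K. Z k \<omega> = z k) = (\<Prod>k\<in>K. \<P>(\<omega> in M. Z k \<omega> = z k))"
proof (cases "K = {}")
  case False
  from indep_varsD_finite[OF assms(1) False assms(2), of "\<lambda>k. {z k}"]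
  have "prob (\<Inter>k\<in>K. Z k -` {z k} \<inter> space M) = (\<Prod>k\<in>K. prob (Z k -` {z k} \<inter> space M))" by simp
  moreover have "(\<Inter>k\<in>K. Z k -` {z k} \<inter> space M) = {\<omega> \<in> space M. \<forall>k\<in>K. Z k \<omega> = z k}"
    using False by auto
  moreover have "Z k -` {z k} \<inter> space M = {\<omega> \<in> space M. Z k \<omega> = z k}" for k by auto
  ultimately show ?thesis by simp
qed (simp add: prob_space)

text \<open>Independence holds across the index \<open>k\<close> only; \<open>X k\<close> and
  \<open>Y k\<close> may depend on each other. All three probabilities in the density of
  \<open>U\<close> and \<open>V\<close> factor over \<open>K\<close>, so the density is almost
  everywhere the sum of the densities of the pairs. \<open>U\<close> and \<open>V\<close> enter
  through their level sets, hence may have any type.\<close>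

lemma mutual_info_indep_family:
  fixes X :: "'k \<Rightarrow> 'a \<Rightarrow> 'b :: finite" and Y :: "'k \<Rightarrow> 'a \<Rightarrow> 'c :: finite"
  assumes b: "b > 1" and K: "finite K"
    and indep: "indep_vars (\<lambda>_. count_space UNIV) (\<lambda>k \<omega>. (X k \<omega>, Y k \<omega>)) K"
    and U: "\<And>\<omega> \<omega>'. \<omega> \<in> space M \<Longrightarrow> \<omega>' \<in> space M \<Longrightarrow>
      U \<omega> = U \<omega>' \<longleftrightarrow> (\<forall>k\<in>K. X k \<omega> = X k \<omega>')"
    and V: "\<And>\<omega> \<omega>'. \<omega> \<in> space M \<Longrightarrow> \<omega>' \<in> space M \<Longrightarrow>
      V \<omega> = V \<omega>' \<longleftrightarrow> (\<forall>k\<in>K. Y k \<omega> = Y k \<omega>')"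
  shows "mutual_info M b U V = (\<Sum>k\<in>K. mutual_info M b (X k) (Y k))"
proof -
  have iX: "indep_vars (\<lambda>_. count_space UNIV) X K"
    using indep_vars_compose2[OF indep, of "\<lambda>_. fst" "\<lambda>_. count_space UNIV"] by simp
  have iY: "indep_vars (\<lambda>_. count_space UNIV) Y K"
    using indep_vars_compose2[OF indep, of "\<lambda>_. snd" "\<lambda>_. count_space UNIV"] by simp
  have sX: "simple_function M (X k)" and sY: "simple_function M (Y k)" if "k \<in> K" for k
    using that iX iY by (auto simp: simple_function_eq_measurable indep_vars_def)
  have sU: "simple_function M U"
    using U by (intro simple_function_family[OF K sX]) auto
  have sV: "simple_function M V"
    using V by (intro simple_function_family[OF K sY]) auto
  have pU: "\<P>(\<omega>' in M. U \<omega>' = U \<omega>) = (\<Prod>k\<in>K. \<P>(\<omega>' in M. X k \<omega>' = X k \<omega>))"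
    if "\<omega> \<in> space M" for \<omega>
    unfolding prob_indep_family[OF iX K, symmetric]
    using U that by (intro arg_cong[where f = prob]) auto
  have pV: "\<P>(\<omega>' in M. V \<omega>' = V \<omega>) = (\<Prod>k\<in>K. \<P>(\<omega>' in M. Y k \<omega>' = Y k \<omega>))"
    if "\<omega> \<in> space M" for \<omega>
    unfolding prob_indep_family[OF iY K, symmetric]
    using V that by (intro arg_cong[where f = prob]) auto
  have pUV: "\<P>(\<omega>' in M. U \<omega>' = U \<omega> \<and> V \<omega>' = V \<omega>) =
      (\<Prod>k\<in>K. \<P>(\<omega>' in M. X k \<omega>' = X k \<omega> \<and> Y k \<omega>' = Y k \<omega>))" if "\<omega> \<in> space M" for \<omega>
  proof -
    have "\<P>(\<omega>' in M. U \<omega>' = U \<omega> \<and> V \<omega>' = V \<omega>) =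
        \<P>(\<omega>' in M. \<forall>k\<in>K. (X k \<omega>', Y k \<omega>') = (X k \<omega>, Y k \<omega>))"
      using U V that by (intro arg_cong[where f = prob]) auto
    also have "\<dots> = (\<Prod>k\<in>K. \<P>(\<omega>' in M. (X k \<omega>', Y k \<omega>') = (X k \<omega>, Y k \<omega>)))"
      by (rule prob_indep_family[OF indep K])
    finally show ?thesis by simp
  qed
  \<comment> \<open>A vanishing factor would make the conventional logarithm of the product 0 while
    other summands survive; such sample points form a finite union of null sets.\<close>
  have pos: "AE \<omega> in M. \<forall>k\<in>K. \<P>(\<omega>' in M. X k \<omega>' = X k \<omega> \<and> Y k \<omega>' = Y k \<omega>) > 0 \<and>
      \<P>(\<omega>' in M. X k \<omega>' = X k \<omega>) > 0 \<and> \<P>(\<omega>' in M. Y k \<omega>' = Y k \<omega>) > 0"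
  proof (rule AE_finite_allI[OF K])
    fix k assume k: "k \<in> K"
    have "simple_function M (\<lambda>\<omega>. (X k \<omega>, Y k \<omega>))" using sX[OF k] sY[OF k] by auto
    from AE_atom_pos[OF this] AE_atom_pos[OF sX[OF k]] AE_atom_pos[OF sY[OF k]]
    show "AE \<omega> in M. \<P>(\<omega>' in M. X k \<omega>' = X k \<omega> \<and> Y k \<omega>' = Y k \<omega>) > 0 \<and>
      \<P>(\<omega>' in M. X k \<omega>' = X k \<omega>) > 0 \<and> \<P>(\<omega>' in M. Y k \<omega>' = Y k \<omega>) > 0"
      by eventually_elim simp
  qed
  have "expectation (info_density b U V) = expectation (\<lambda>\<omega>. \<Sum>k\<in>K. info_density b (X k) (Y k) \<omega>)"
  proof (rule integral_cong_AE)
    show "info_density b U V \<in> borel_measurable M"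
      using info_density_sum(2)[OF sU sV simple_functionD(1)[OF simple_function_Pair[OF sU sV]] order.refl]
      by (rule borel_measurable_integrable)
    show "(\<lambda>\<omega>. \<Sum>k\<in>K. info_density b (X k) (Y k) \<omega>) \<in> borel_measurable M"
      using info_density_sum(2)[OF sX sY finite_class.finite_UNIV subset_UNIV]
      by (intro borel_measurable_sum) auto
    show "AE \<omega> in M. info_density b U V \<omega> = (\<Sum>k\<in>K. info_density b (X k) (Y k) \<omega>)"
      using pos AE_space
    proof eventually_elim
      case (elim \<omega>)
      let ?d = "\<lambda>k. \<P>(\<omega>' in M. X k \<omega>' = X k \<omega> \<and> Y k \<omega>' = Y k \<omega>) /
        (\<P>(\<omega>' in M. X k \<omega>' = X k \<omega>) * \<P>(\<omega>' in M. Y k \<omega>' = Y k \<omega>))"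
      have "info_density b U V \<omega> = log b (\<Prod>k\<in>K. ?d k)"
        using elim by (simp add: info_density_def pU pV pUV prod.distrib prod_dividef)
      also have "\<dots> = (\<Sum>k\<in>K. log b (?d k))"
        unfolding log_def sum_divide_distrib[symmetric]
        by (subst ln_prod[OF K]) (use elim in force)+
      finally show ?case by (simp add: info_density_def)
    qed
  qed
  also have "\<dots> = (\<Sum>k\<in>K. expectation (info_density b (X k) (Y k)))"
    using info_density_sum(2)[OF sX sY finite_class.finite_UNIV subset_UNIV]
    by (intro Bochner_Integration.integral_sum) auto
  finally show ?thesis
    by (simp add: mutual_info_eq_expectation[OF b] sU sV sX sY)
qed

end

section \<open>Cyclic windows of sub-shares\<close>

definition window :: "nat \<Rightarrow> nat \<Rightarrow> nat \<Rightarrow> nat set" where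
  "window n \<xi> c = (\<lambda>j. (c + j) mod n) ` {..\<xi>}"

lemma add_mod_cancel_nat:
  assumes "a < n" "b < (n :: nat)"
  shows "(c + a) mod n = (c + b) mod n \<longleftrightarrow> a = b"
proof -
  have *: "a' = b'" if "a' \<le> b'" "b' < n" "(c + b') mod n = (c + a') mod n" for a' b'
  proof -
    have "n dvd (c + b') - (c + a')"
      using that mod_eq_dvd_iff_nat[of "c + a'" "c + b'" n] by simp
    moreover have "(c + b') - (c + a') < n" using that by simp
    ultimately have "(c + b') - (c + a') = 0" using nat_dvd_not_less by blast
    then show ?thesis using that by simp
  qed
  show ?thesis
    using *[of a b] *[of b a] assms by (metis nat_le_linear)
qed

lemma card_window: "\<xi> < n \<Longrightarrow> card (window n \<xi> c) = \<xi> + 1"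
  unfolding window_def by (subst card_image) (auto simp: inj_on_def add_mod_cancel_nat)

lemma window_subset: "n > 0 \<Longrightarrow> window n \<xi> c \<subseteq> {..<n}"
  by (auto simp: window_def)

text \<open>Counted from \<open>i\<close>, the first window uses offsets below n / 2 and the second
  offsets from n / 2 to n - 1. Distinct offsets below \<open>n\<close> stay distinct modulo
  \<open>n\<close>.\<close>

lemma window_disjoint:
  assumes "n > 0" "even n" "\<xi> \<le> n div 2 - 1"
  shows "window n \<xi> i \<inter> window n \<xi> (n div 2 + i) = {}"
proof -
  have "(i + j) mod n \<noteq> (n div 2 + i + j') mod n" if "j \<le> \<xi>" "j' \<le> \<xi>" for j j'
  proof -
    have "n = 2 * (n div 2)" using assms by simp
    then have "j < n" "n div 2 + j' < n" "j \<noteq> n div 2 + j'" using assms that by linarith+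
    then have "(i + j) mod n \<noteq> (i + (n div 2 + j')) mod n"
      using add_mod_cancel_nat[of j n "n div 2 + j'" i] by simp
    then show ?thesis by (simp add: ac_simps)
  qed
  then show ?thesis unfolding window_def by auto
qed

text \<open>
  The centres whose windows contain \<open>m\<close> form again a window, of size \<open>\<xi> + 1\<close>, which is too
  large to avoid a set of \<open>n - \<xi>\<close> nodes.
\<close>

lemma window_cover:
  assumes "\<xi> < n" "c \<le> n" "m < n" "S \<subseteq> {..<n}" "card S = n - \<xi>"
  shows "\<exists>i\<in>S. m \<in> window n \<xi> (c + i)"
proof -
  \<comment> \<open>The arc starts at m - c - \<xi> modulo \<open>n\<close>, written with two
    multiples of \<open>n\<close> added so that no subtraction is truncated. It ends at m -
    c.\<close>
  let ?T = "window n \<xi> (m + (n - c) + (n - \<xi>))"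
  have T: "?T \<subseteq> {..<n}" using assms by (intro window_subset) simp
  have "S \<inter> ?T \<noteq> {}"
  proof
    assume "S \<inter> ?T = {}"
    moreover have "finite S" "finite ?T" using T assms(4) finite_subset by blast+
    ultimately have "card (S \<union> ?T) = n - \<xi> + (\<xi> + 1)"
      using assms by (simp add: card_Un_disjoint card_window)
    moreover have "card (S \<union> ?T) \<le> card {..<n}" using T assms(4) by (intro card_mono) auto
    ultimately show False using assms(1) by simp
  qed
  then obtain i j where i: "i \<in> S" "j \<le> \<xi>" "i = (m + (n - c) + (n - \<xi>) + j) mod n"
    by (auto simp: window_def)
  \<comment> \<open>A node at position \<open>j\<close> of the arc sees \<open>m\<close> at the
    complementary offset \<open>\<xi> - j\<close> of its own window; the total shift is m +
    2n.\<close>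
  have "c + i + (\<xi> - j) = c + (\<xi> - j) + (m + (n - c) + (n - \<xi>) + j) mod n"
    using i(3) by simp
  then have "(c + i + (\<xi> - j)) mod n = (c + (\<xi> - j) + (m + (n - c) + (n - \<xi>) + j)) mod n"
    by (simp only: mod_add_right_eq)
  also have "c + (\<xi> - j) + (m + (n - c) + (n - \<xi>) + j) = m + n * 2"
    using assms i by simp
  finally have "(c + i + (\<xi> - j)) mod n = m" using assms by simp
  then have "m \<in> window n \<xi> (c + i)"
    unfolding window_def by (metis atMost_iff diff_le_self image_eqI)
  with i(1) show ?thesis ..
qed

section \<open>Entry positions covered by sub-shares\<close>

definition block_cells :: "nat \<Rightarrow> nat \<Rightarrow> nat \<Rightarrow> nat set \<Rightarrow> (nat \<times> nat) set" where
  "block_cells n r l B = {(u, v). u < r \<and> v < l \<and> u div (r div n) \<in> B}"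

lemma block_cells_subset: "block_cells n r l B \<subseteq> {..<r} \<times> {..<l}"
  by (auto simp: block_cells_def)

lemma finite_block_cells [simp]: "finite (block_cells n r l B)"
  by (rule finite_subset[OF block_cells_subset]) simp

text \<open>Passes between positions in the full matrix, where disjointness of blocks is visible,
  and positions inside one sub-share. The hypothesis \<open>m < n\<close> keeps the shifted rows
  below \<open>r\<close>.\<close>

lemma block_cells_singleton:
  assumes "m < n" "n dvd r"
  shows "block_cells n r l {m} = (\<lambda>(u, v). (m * (r div n) + u, v)) ` ({..<r div n} \<times> {..<l})"
proof -
  define h where "h = r div n"
  have r: "r = n * h" using assms by (simp add: h_def)
  have lt: "m * h + u < r" if "u < h" for u
  proof -
    have "m * h + u < (m + 1) * h" using that by simp
    also have "\<dots> \<le> n * h" using assms by (intro mult_right_mono) auto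
    finally show ?thesis by (simp add: r)
  qed
  have "(u, v) \<in> (\<lambda>(u, v). (m * h + u, v)) ` ({..<h} \<times> {..<l})"
    if "u < r" "v < l" "u div h = m" for u v
  proof -
    have "h > 0" using that r by (cases h) auto
    then have "u mod h < h" by simp
    moreover have "u = m * h + u mod h" using that(3) div_mult_mod_eq[of u h] by simp
    ultimately show ?thesis using that(2) by (auto simp: image_iff)
  qed
  moreover have "(m * h + u) div h = m" if "u < h" for u
    using that by simp
  ultimately show ?thesis
    using lt unfolding block_cells_def h_def[symmetric] by auto
qed

lemma inj_on_block_shift: "inj_on (\<lambda>(u, v). (k + u, v)) (D :: (nat \<times> nat) set)"
  by (auto simp: inj_on_def)

lemma card_block_cells:
  assumes "n > 0" "n dvd r" "B \<subseteq> {..<n}"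
  shows "card (block_cells n r l B) = card B * (r div n * l)"
proof -
  have "finite B" using assms(3) finite_subset by blast
  have disj: "\<forall>m\<in>B. \<forall>m'\<in>B. m \<noteq> m' \<longrightarrow> block_cells n r l {m} \<inter> block_cells n r l {m'} = {}"
    by (auto simp: block_cells_def)
  have "block_cells n r l B = (\<Union>m\<in>B. block_cells n r l {m})"
    by (auto simp: block_cells_def)
  also have "card \<dots> = (\<Sum>m\<in>B. card (block_cells n r l {m}))"
    by (rule card_UN_disjoint[OF \<open>finite B\<close> _ disj]) simp
  also have "\<dots> = (\<Sum>m\<in>B. r div n * l)"
  proof (rule sum.cong)
    fix m assume "m \<in> B"
    then have "m < n" using assms(3) by auto
    then show "card (block_cells n r l {m}) = r div n * l"
      by (simp add: block_cells_singleton assms(2) card_image inj_on_block_shift)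
  qed simp
  finally show ?thesis by simp
qed

lemma sub_share_eq_iff:
  assumes "X \<in> carrier_mat r l" "X' \<in> carrier_mat r l" "m < n" "n dvd r"
  shows "sub_share n X m = sub_share n X' m \<longleftrightarrow> (\<forall>uv\<in>block_cells n r l {m}. X $$ uv = X' $$ uv)"
  using assms unfolding block_cells_singleton[OF assms(3,4)]
  by (auto simp: sub_share_def mat_eq_iff)

text \<open>Both leakage and reconstruction see a node only through this equivalence, which replaces
  lists of matrices by two sets of cells.\<close>

lemma node_content_eq_iff:
  assumes "B \<in> carrier_mat r l" "B' \<in> carrier_mat r l" "R \<in> carrier_mat r l" "R' \<in> carrier_mat r l"
    and "n > 0" "n dvd r"
  shows "node_content n \<xi> B R i = node_content n \<xi> B' R' i \<longleftrightarrow>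
    (\<forall>uv\<in>block_cells n r l (window n \<xi> i). B $$ uv = B' $$ uv) \<and>
    (\<forall>uv\<in>block_cells n r l (window n \<xi> (n div 2 + i)). R $$ uv = R' $$ uv)"
proof -
  have "map (\<lambda>j. sub_share n X ((c + j) mod n)) [0..<\<xi> + 1] =
      map (\<lambda>j. sub_share n X' ((c + j) mod n)) [0..<\<xi> + 1] \<longleftrightarrow>
      (\<forall>uv\<in>block_cells n r l (window n \<xi> c). X $$ uv = X' $$ uv)"
    if X: "X \<in> carrier_mat r l" "X' \<in> carrier_mat r l" for X X' :: "'a mat" and c
  proof -
    have "(\<forall>j\<le>\<xi>. sub_share n X ((c + j) mod n) = sub_share n X' ((c + j) mod n)) \<longleftrightarrow>
        (\<forall>j\<le>\<xi>. \<forall>uv\<in>block_cells n r l {(c + j) mod n}. X $$ uv = X' $$ uv)"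
      using sub_share_eq_iff[OF X _ assms(6)] assms(5) by simp
    also have "\<dots> \<longleftrightarrow> (\<forall>uv\<in>block_cells n r l (window n \<xi> c). X $$ uv = X' $$ uv)"
      unfolding block_cells_def window_def by blast
    finally show ?thesis by (simp add: Ball_def atLeast0LessThan lessThan_Suc_atMost del: upt_Suc)
  qed
  from this[of B B' i] this[of R R' "n div 2 + i"] show ?thesis
    using assms by (simp add: node_content_def del: upt_Suc)
qed

section \<open>Expected number of stored bits\<close>

lemma nnz_sub_share:
  assumes "X \<in> carrier_mat r l" "m < n" "n dvd r"
  shows "real (nnz (sub_share n X m)) = (\<Sum>uv\<in>block_cells n r l {m}. of_bool (X $$ uv \<noteq> 0))"
proof -
  let ?f = "\<lambda>(u, v). (m * (r div n) + u, v)"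
  have "{(u, v). u < r div n \<and> v < l \<and> sub_share n X m $$ (u, v) \<noteq> 0} =
      {uv \<in> {..<r div n} \<times> {..<l}. X $$ ?f uv \<noteq> 0}"
    using assms(1) by (auto simp: sub_share_def)
  then have "real (nnz (sub_share n X m)) = real (card {uv \<in> {..<r div n} \<times> {..<l}. X $$ ?f uv \<noteq> 0})"
    using assms(1) by (simp add: nnz_def sub_share_def)
  also have "\<dots> = (\<Sum>uv\<in>{..<r div n} \<times> {..<l}. of_bool (X $$ ?f uv \<noteq> 0))"
    by (simp add: of_bool_def sum.If_cases Int_def conj_commute)
  also have "\<dots> = (\<Sum>uv\<in>block_cells n r l {m}. of_bool (X $$ uv \<noteq> 0))"
    unfolding block_cells_singleton[OF assms(2,3)]
    by (subst sum.reindex[OF inj_on_block_shift]) (simp add: comp_def)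
  finally show ?thesis .
qed

text \<open>Linearity of expectation: each cell of the sub-share is non-zero with probability
  \<open>1 - t\<close> and then costs a fixed number of bits. Integrability is stated too, so that
  the expectations of several sub-shares can be added.\<close>

lemma (in prob_space) expectation_sparse_bits:
  fixes X :: "'a \<Rightarrow> 'f :: {field, finite} mat"
  assumes X: "\<And>\<omega>. \<omega> \<in> space M \<Longrightarrow> X \<omega> \<in> carrier_mat r l"
    and simple: "\<And>u v. u < r \<Longrightarrow> v < l \<Longrightarrow> simple_function M (\<lambda>\<omega>. X \<omega> $$ (u, v))"
    and zero: "\<And>u v. u < r \<Longrightarrow> v < l \<Longrightarrow> \<P>(\<omega> in M. X \<omega> $$ (u, v) = 0) = t"
    and n: "m < n" "n dvd r"
  shows "expectation (\<lambda>\<omega>. sparse_bits (sub_share n (X \<omega>) m)) =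
      real (r div n * l) * (1 - t) *
        (real_of_int \<lceil>log 2 (real CARD('f))\<rceil> + real_of_int \<lceil>log 2 (real (r div n * l))\<rceil>)"
    and "integrable M (\<lambda>\<omega>. sparse_bits (sub_share n (X \<omega>) m))"
proof -
  define c where "c = real_of_int \<lceil>log 2 (real CARD('f))\<rceil> + real_of_int \<lceil>log 2 (real (r div n * l))\<rceil>"
  let ?g = "\<lambda>\<omega>. (\<Sum>uv\<in>block_cells n r l {m}. of_bool (X \<omega> $$ uv \<noteq> 0)) * c"
  have eq: "sparse_bits (sub_share n (X \<omega>) m) = ?g \<omega>" if "\<omega> \<in> space M" for \<omega>
    using X[OF that] nnz_sub_share[OF X[OF that] n]
    by (simp add: sparse_bits_def sub_share_def c_def)
  have cell: "integrable M (\<lambda>\<omega>. of_bool (X \<omega> $$ uv \<noteq> 0) :: real)"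
    "expectation (\<lambda>\<omega>. of_bool (X \<omega> $$ uv \<noteq> 0)) = 1 - t"
    if cell: "uv \<in> block_cells n r l {m}" for uv
  proof -
    obtain u v where uv: "uv = (u, v)" "u < r" "v < l"
      using cell by (cases uv) (auto simp: block_cells_def)
    have ev: "{\<omega> \<in> space M. X \<omega> $$ (u, v) = 0} \<in> events" "{\<omega> \<in> space M. X \<omega> $$ (u, v) \<noteq> 0} \<in> events"
      using simple_function_sets[OF simple[OF uv(2,3)], of "\<lambda>x. x = 0"]
        simple_function_sets[OF simple[OF uv(2,3)], of "\<lambda>x. x \<noteq> 0"] by simp_all
    have of_bool: "of_bool (X \<omega> $$ uv \<noteq> 0) = (indicator {\<omega> \<in> space M. X \<omega> $$ (u, v) \<noteq> 0} \<omega> :: real)"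
      if "\<omega> \<in> space M" for \<omega>
      using that by (simp add: uv indicator_def)
    show "integrable M (\<lambda>\<omega>. of_bool (X \<omega> $$ uv \<noteq> 0) :: real)"
      using ev(2) by (subst Bochner_Integration.integrable_cong[OF refl of_bool])
        (auto simp: emeasure_eq_measure)
    have "expectation (\<lambda>\<omega>. of_bool (X \<omega> $$ uv \<noteq> 0)) = \<P>(\<omega> in M. X \<omega> $$ (u, v) \<noteq> 0)"
      using ev(2) by (subst Bochner_Integration.integral_cong[OF refl of_bool])
        (auto simp: sets.Int_space_eq2)
    then show "expectation (\<lambda>\<omega>. of_bool (X \<omega> $$ uv \<noteq> 0)) = 1 - t"
      using prob_neg[OF ev(1)] zero[OF uv(2,3)] by simp
  qed
  have "integrable M ?g"
    using cell(1) by (intro integrable_mult_left Bochner_Integration.integrable_sum)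
  then show "integrable M (\<lambda>\<omega>. sparse_bits (sub_share n (X \<omega>) m))"
    by (subst Bochner_Integration.integrable_cong[OF refl eq])
  have "expectation (\<lambda>\<omega>. sparse_bits (sub_share n (X \<omega>) m)) = expectation ?g"
    by (rule Bochner_Integration.integral_cong[OF refl eq])
  also have "\<dots> = (\<Sum>uv\<in>block_cells n r l {m}. expectation (\<lambda>\<omega>. of_bool (X \<omega> $$ uv \<noteq> 0))) * c"
    using cell(1) by (simp only: integral_mult_left_zero Bochner_Integration.integral_sum)
  also have "\<dots> = real (card (block_cells n r l {m})) * (1 - t) * c"
    using cell(2) by simp
  also have "card (block_cells n r l {m}) = r div n * l"
    using n by (subst card_block_cells) auto
  finally show "expectation (\<lambda>\<omega>. sparse_bits (sub_share n (X \<omega>) m)) =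
      real (r div n * l) * (1 - t) *
        (real_of_int \<lceil>log 2 (real CARD('f))\<rceil> + real_of_int \<lceil>log 2 (real (r div n * l))\<rceil>)"
    by (simp add: c_def)
qed

lemma (in prob_space) expectation_node_bits:
  fixes X Y :: "'a \<Rightarrow> 'f :: {field, finite} mat"
  assumes X: "\<And>\<omega>. \<omega> \<in> space M \<Longrightarrow> X \<omega> \<in> carrier_mat r l"
      "\<And>u v. u < r \<Longrightarrow> v < l \<Longrightarrow> simple_function M (\<lambda>\<omega>. X \<omega> $$ (u, v))"
      "\<And>u v. u < r \<Longrightarrow> v < l \<Longrightarrow> \<P>(\<omega> in M. X \<omega> $$ (u, v) = 0) = s"
    and Y: "\<And>\<omega>. \<omega> \<in> space M \<Longrightarrow> Y \<omega> \<in> carrier_mat r l"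
      "\<And>u v. u < r \<Longrightarrow> v < l \<Longrightarrow> simple_function M (\<lambda>\<omega>. Y \<omega> $$ (u, v))"
      "\<And>u v. u < r \<Longrightarrow> v < l \<Longrightarrow> \<P>(\<omega> in M. Y \<omega> $$ (u, v) = 0) = t"
    and n: "n > 0" "n dvd r"
  shows "expectation (\<lambda>\<omega>. node_bits (node_content n \<xi> (X \<omega>) (Y \<omega>) i)) =
      real (\<xi> + 1) * ((1 - s) + (1 - t)) * real (r div n * l) *
        (real_of_int \<lceil>log 2 (real CARD('f))\<rceil> + real_of_int \<lceil>log 2 (real (r div n * l))\<rceil>)"
proof -
  have bits: "node_bits (node_content n \<xi> B C i) =
      (\<Sum>j\<le>\<xi>. sparse_bits (sub_share n B ((i + j) mod n))) +
      (\<Sum>j\<le>\<xi>. sparse_bits (sub_share n C ((n div 2 + i + j) mod n)))" for B C :: "'f mat"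
    by (simp add: node_bits_def node_content_def comp_def interv_sum_list_conv_sum_set_nat
        atLeast0LessThan lessThan_Suc_atMost del: upt_Suc)
  have lt: "k mod n < n" for k using n by simp
  note [simp] = expectation_sparse_bits[OF X lt n(2)] expectation_sparse_bits[OF Y lt n(2)]
  show ?thesis
    unfolding bits by (simp add: algebra_simps)
qed

section \<open>The scheme\<close>

lemma block_cells_disjoint:
  "B \<inter> B' = {} \<Longrightarrow> block_cells n r l B \<inter> block_cells n r l B' = {}"
  by (auto simp: block_cells_def)

context sparse_shares
begin

section \<open>Law and leakage of a single cell\<close>

lemma entry_pair_simple:
  assumes "u < r" "v < l"
  shows "simple_function M (\<lambda>\<omega>. (A \<omega> $$ (u, v), R \<omega> $$ (u, v)))"
  using indep_entries assms by (auto simp: simple_function_eq_measurable indep_vars_def)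

text \<open>The right-hand side is free of \<open>u\<close> and \<open>v\<close>: this is the
  identical distribution of the entry pairs.\<close>

lemma entry_pair_law:
  assumes "u < r" "v < l"
  shows "\<P>(\<omega> in M. (A \<omega> $$ (u, v), R \<omega> $$ (u, v)) = (a, x)) =
    (if a = 0 then s * (if x = 0 then p1 else p1_inv)
     else (1 - s) / (real q - 1) * (if x = 0 then p2 else if x = - a then p3 else p23_inv))"
proof -
  define w where "w = (if a = 0 then if x = 0 then p1 else p1_inv
    else if x = 0 then p2 else if x = - a then p3 else p23_inv)"
  define c where "c = (if a = 0 then s else (1 - s) / (real q - 1))"
  \<comment> \<open>The conditioning event must have positive probability before the quotient
    defining the conditional probability can be cleared; this uses both bounds on
    \<open>s\<close>.\<close>
  have "0 \<le> 1 / real q" by simp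
  then have "s > 0" using s_bounds(1) by linarith
  then have "c > 0" using s_bounds(2) q_ge_3 by (simp add: c_def)
  have "\<P>(\<omega> in M. A \<omega> $$ (u, v) = a) = c"
    using A_zero[OF assms] A_nonzero[OF assms] by (simp add: c_def)
  moreover have "\<P>(\<omega> in M. R \<omega> $$ (u, v) = x \<bar> A \<omega> $$ (u, v) = a) = w"
    using R_given_zero[OF assms, of x] R_given_nonzero[OF assms, of a x]
    unfolding w_def by (cases "a = 0") simp_all
  ultimately have "\<P>(\<omega> in M. R \<omega> $$ (u, v) = x \<and> A \<omega> $$ (u, v) = a) / c = w"
    by (simp only: cond_prob_def)
  then have "\<P>(\<omega> in M. R \<omega> $$ (u, v) = x \<and> A \<omega> $$ (u, v) = a) = c * w"
    using \<open>c > 0\<close> by auto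
  moreover have "{\<omega> \<in> space M. (A \<omega> $$ (u, v), R \<omega> $$ (u, v)) = (a, x)} =
      {\<omega> \<in> space M. R \<omega> $$ (u, v) = x \<and> A \<omega> $$ (u, v) = a}"
    by auto
  ultimately show ?thesis by (simp add: c_def w_def)
qed

text \<open>Leakage about one private entry when \<open>h\<close> of the pair (private entry,
  padding entry) is observed. The cell \<open>(0, 0)\<close> represents all cells.\<close>

definition entry_info :: "('f \<times> 'f \<Rightarrow> 'f) \<Rightarrow> real" where
  "entry_info h = mutual_info M (real q) (\<lambda>\<omega>. A \<omega> $$ (0, 0)) (\<lambda>\<omega>. h (A \<omega> $$ (0, 0), R \<omega> $$ (0, 0)))"

text \<open>The observed function \<open>h\<close> may change from cell to cell. Whole shares use
  the same \<open>h\<close> everywhere; a node needs three different ones.\<close>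

lemma mutual_info_cellwise:
  fixes h :: "nat \<times> nat \<Rightarrow> 'f \<times> 'f \<Rightarrow> 'f"
  assumes V: "\<And>\<omega> \<omega>'. \<omega> \<in> space M \<Longrightarrow> \<omega>' \<in> space M \<Longrightarrow> V \<omega> = V \<omega>' \<longleftrightarrow>
    (\<forall>uv\<in>{..<r} \<times> {..<l}. h uv (A \<omega> $$ uv, R \<omega> $$ uv) = h uv (A \<omega>' $$ uv, R \<omega>' $$ uv))"
  shows "mutual_info M (real q) A V = (\<Sum>uv\<in>{..<r} \<times> {..<l}. entry_info (h uv))"
proof -
  have q: "real q > 1" using q_ge_3 by simp
  have "mutual_info M (real q) A V = (\<Sum>uv\<in>{..<r} \<times> {..<l}.
      mutual_info M (real q) (\<lambda>\<omega>. A \<omega> $$ uv) (\<lambda>\<omega>. h uv (A \<omega> $$ uv, R \<omega> $$ uv)))"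
  proof (rule mutual_info_indep_family[OF q _ _ _ V])
    show "indep_vars (\<lambda>_. count_space UNIV)
        (\<lambda>uv \<omega>. (A \<omega> $$ uv, h uv (A \<omega> $$ uv, R \<omega> $$ uv))) ({..<r} \<times> {..<l})"
      using indep_vars_compose2[OF indep_entries,
          of "\<lambda>uv z. (fst z, h uv z)" "\<lambda>_. count_space UNIV"] by simp
    fix \<omega> \<omega>' assume "\<omega> \<in> space M" "\<omega>' \<in> space M"
    then show "A \<omega> = A \<omega>' \<longleftrightarrow> (\<forall>uv\<in>{..<r} \<times> {..<l}. A \<omega> $$ uv = A \<omega>' $$ uv)"
      using A_carrier[of \<omega>] A_carrier[of \<omega>'] by (auto simp: mat_eq_iff)
  qed simp
  also have "\<dots> = (\<Sum>uv\<in>{..<r} \<times> {..<l}. entry_info (h uv))"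
  proof (rule sum.cong)
    fix w :: "nat \<times> nat"
    obtain u v where w: "w = (u, v)" by (cases w)
    assume "w \<in> {..<r} \<times> {..<l}"
    then have uv: "u < r" "v < l" by (auto simp: w)
    define Z where "Z uv = (\<lambda>\<omega>. (A \<omega> $$ uv, R \<omega> $$ uv))" for uv
    have Z: "simple_function M (Z (u, v))" "simple_function M (Z (0, 0))"
      using entry_pair_simple uv r_pos l_pos by (auto simp: Z_def)
    have law: "\<P>(\<omega> in M. Z (u, v) \<omega> = z) = \<P>(\<omega> in M. Z (0, 0) \<omega> = z)" for z
      unfolding Z_def by (cases z) (simp only: entry_pair_law[OF uv] entry_pair_law[OF r_pos l_pos])
    have sZ: "simple_function M (\<lambda>\<omega>. g (Z (u, v) \<omega>))" "simple_function M (\<lambda>\<omega>. g (Z (0, 0) \<omega>))"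
      for g :: "'f \<times> 'f \<Rightarrow> 'f"
      using Z by (blast intro: simple_function_compose1)+
    have "mutual_info M (real q) (\<lambda>\<omega>. fst (Z (u, v) \<omega>)) (\<lambda>\<omega>. h (u, v) (Z (u, v) \<omega>)) =
        mutual_info M (real q) (\<lambda>\<omega>. fst (Z (0, 0) \<omega>)) (\<lambda>\<omega>. h (u, v) (Z (0, 0) \<omega>))"
    proof (rule mutual_info_cong_law[OF q])
      fix x y
      show "\<P>(\<omega> in M. fst (Z (u, v) \<omega>) = x \<and> h (u, v) (Z (u, v) \<omega>) = y) =
          \<P>(\<omega> in M. fst (Z (0, 0) \<omega>) = x \<and> h (u, v) (Z (0, 0) \<omega>) = y)"
        using Z[THEN prob_law_pred, of "\<lambda>z. fst z = x \<and> h (u, v) z = y"] law by simp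
    qed (rule sZ)+
    then show "mutual_info M (real q) (\<lambda>\<omega>. A \<omega> $$ w) (\<lambda>\<omega>. h w (A \<omega> $$ w, R \<omega> $$ w)) =
        entry_info (h w)"
      by (simp add: w Z_def entry_info_def)
  qed simp
  finally show ?thesis .
qed

lemma entry_info_const: "entry_info (\<lambda>_. c) = 0"
  unfolding entry_info_def
  using q_ge_3 simple_function_compose1[OF entry_pair_simple[OF r_pos l_pos], of fst]
  by (intro mutual_info_const) auto

section \<open>Leakage of the shares and of a node\<close>

lemma sum_carrier: "\<omega> \<in> space M \<Longrightarrow> A \<omega> + R \<omega> \<in> carrier_mat r l"
  using A_carrier R_carrier by simp

lemma sum_index:
  "\<omega> \<in> space M \<Longrightarrow> uv \<in> {..<r} \<times> {..<l} \<Longrightarrow> (A \<omega> + R \<omega>) $$ uv = A \<omega> $$ uv + R \<omega> $$ uv"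
  using R_carrier[of \<omega>] by auto

lemma mutual_info_pad: "mutual_info M (real q) A R = real (r * l) * entry_info snd"
proof -
  have "mutual_info M (real q) A R = (\<Sum>uv\<in>{..<r} \<times> {..<l}. entry_info snd)"
  proof (rule mutual_info_cellwise)
    fix \<omega> \<omega>' assume "\<omega> \<in> space M" "\<omega>' \<in> space M"
    then show "R \<omega> = R \<omega>' \<longleftrightarrow> (\<forall>uv\<in>{..<r} \<times> {..<l}.
        snd (A \<omega> $$ uv, R \<omega> $$ uv) = snd (A \<omega>' $$ uv, R \<omega>' $$ uv))"
      using R_carrier[of \<omega>] R_carrier[of \<omega>'] by (auto simp: mat_eq_iff)
  qed
  then show ?thesis by simp
qed

lemma mutual_info_sum:
  "mutual_info M (real q) A (\<lambda>\<omega>. A \<omega> + R \<omega>) = real (r * l) * entry_info (\<lambda>(a, x). a + x)"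
proof -
  have "mutual_info M (real q) A (\<lambda>\<omega>. A \<omega> + R \<omega>) =
      (\<Sum>uv\<in>{..<r} \<times> {..<l}. entry_info (\<lambda>(a, x). a + x))"
  proof (rule mutual_info_cellwise)
    fix \<omega> \<omega>' assume \<omega>: "\<omega> \<in> space M" "\<omega>' \<in> space M"
    have "A \<omega> + R \<omega> = A \<omega>' + R \<omega>' \<longleftrightarrow>
        (\<forall>uv\<in>{..<r} \<times> {..<l}. (A \<omega> + R \<omega>) $$ uv = (A \<omega>' + R \<omega>') $$ uv)"
      using sum_carrier[OF \<omega>(1)] sum_carrier[OF \<omega>(2)]
      unfolding mat_eq_iff carrier_mat_def by auto
    then show "A \<omega> + R \<omega> = A \<omega>' + R \<omega>' \<longleftrightarrow> (\<forall>uv\<in>{..<r} \<times> {..<l}.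
        (case (A \<omega> $$ uv, R \<omega> $$ uv) of (a, x) \<Rightarrow> a + x) =
        (case (A \<omega>' $$ uv, R \<omega>' $$ uv) of (a, x) \<Rightarrow> a + x))"
      using sum_index[OF \<omega>(1)] sum_index[OF \<omega>(2)] by simp
  qed
  then show ?thesis by simp
qed

lemma mutual_info_node:
  assumes n: "n > 0" "even n" "n dvd r" and \<xi>: "\<xi> \<le> n div 2 - 1"
  shows "mutual_info M (real q) A (\<lambda>\<omega>. node_content n \<xi> (A \<omega> + R \<omega>) (R \<omega>) i) =
    real (\<xi> + 1) * (mutual_info M (real q) A R +
      mutual_info M (real q) A (\<lambda>\<omega>. A \<omega> + R \<omega>)) / real n"
proof -
  define D where "D c = block_cells n r l (window n \<xi> c)" for c
  define K where "K = {..<r} \<times> {..<l}"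
  let ?i' = "n div 2 + i"
  let ?add = "\<lambda>(a, x). a + x :: 'f"
  \<comment> \<open>What the node learns at each cell: the padded entry, the padding entry, or the
    constant 0 where it stores nothing. Since \<open>D i\<close> and \<open>D ?i'\<close> are
    disjoint, the order of the tests does not hide any stored entry.\<close>
  define h :: "nat \<times> nat \<Rightarrow> 'f \<times> 'f \<Rightarrow> 'f" where
    "h uv = (if uv \<in> D i then ?add else if uv \<in> D ?i' then snd else (\<lambda>_. 0))" for uv
  have disj: "D i \<inter> D ?i' = {}"
    unfolding D_def by (rule block_cells_disjoint[OF window_disjoint[OF n(1,2) \<xi>]])
  have sub: "D c \<subseteq> K" for c
    unfolding D_def K_def by (rule block_cells_subset)
  have "\<xi> < n" using \<xi> n(1) by linarith
  then have card: "card (D c) = (\<xi> + 1) * (r div n * l)" for c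
    unfolding D_def
    by (simp only: card_block_cells[OF n(1,3) window_subset[OF n(1)]] card_window)
  have "mutual_info M (real q) A (\<lambda>\<omega>. node_content n \<xi> (A \<omega> + R \<omega>) (R \<omega>) i) =
      (\<Sum>uv\<in>K. entry_info (h uv))"
    unfolding K_def
  proof (rule mutual_info_cellwise, fold K_def)
    fix \<omega> \<omega>' assume \<omega>: "\<omega> \<in> space M" "\<omega>' \<in> space M"
    have "node_content n \<xi> (A \<omega> + R \<omega>) (R \<omega>) i = node_content n \<xi> (A \<omega>' + R \<omega>') (R \<omega>') i \<longleftrightarrow>
        (\<forall>uv\<in>D i. (A \<omega> + R \<omega>) $$ uv = (A \<omega>' + R \<omega>') $$ uv) \<and>
        (\<forall>uv\<in>D ?i'. R \<omega> $$ uv = R \<omega>' $$ uv)"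
      unfolding D_def
      by (rule node_content_eq_iff[OF sum_carrier[OF \<omega>(1)] sum_carrier[OF \<omega>(2)]
          R_carrier[OF \<omega>(1)] R_carrier[OF \<omega>(2)] n(1,3)])
    also have "\<dots> \<longleftrightarrow> (\<forall>uv\<in>D i. A \<omega> $$ uv + R \<omega> $$ uv = A \<omega>' $$ uv + R \<omega>' $$ uv) \<and>
        (\<forall>uv\<in>D ?i'. R \<omega> $$ uv = R \<omega>' $$ uv)"
      using sum_index[OF \<omega>(1) subsetD[OF sub[of i, unfolded K_def]]]
        sum_index[OF \<omega>(2) subsetD[OF sub[of i, unfolded K_def]]]
      by (intro conj_cong ball_cong refl) (simp only:)
    also have "\<dots> \<longleftrightarrow> (\<forall>uv\<in>K. h uv (A \<omega> $$ uv, R \<omega> $$ uv) = h uv (A \<omega>' $$ uv, R \<omega>' $$ uv))"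
    proof -
      have "h uv (A \<omega> $$ uv, R \<omega> $$ uv) = h uv (A \<omega>' $$ uv, R \<omega>' $$ uv) \<longleftrightarrow>
          (uv \<in> D i \<longrightarrow> A \<omega> $$ uv + R \<omega> $$ uv = A \<omega>' $$ uv + R \<omega>' $$ uv) \<and>
          (uv \<in> D ?i' \<longrightarrow> R \<omega> $$ uv = R \<omega>' $$ uv)" for uv
      proof -
        consider "uv \<in> D i" "uv \<notin> D ?i'" | "uv \<notin> D i" using disj by blast
        then show ?thesis by cases (simp_all add: h_def)
      qed
      then show ?thesis using sub by blast
    qed
    finally show "node_content n \<xi> (A \<omega> + R \<omega>) (R \<omega>) i = node_content n \<xi> (A \<omega>' + R \<omega>') (R \<omega>') i \<longleftrightarrow>
        (\<forall>uv\<in>K. h uv (A \<omega> $$ uv, R \<omega> $$ uv) = h uv (A \<omega>' $$ uv, R \<omega>' $$ uv))" .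
  qed
  also have "\<dots> = (\<Sum>uv\<in>K. (if uv \<in> D i then entry_info ?add else 0) +
      (if uv \<in> D ?i' then entry_info snd else 0))"
  proof (rule sum.cong)
    fix uv
    consider "uv \<in> D i" "uv \<notin> D ?i'" | "uv \<notin> D i" using disj by blast
    then show "entry_info (h uv) = (if uv \<in> D i then entry_info ?add else 0) +
        (if uv \<in> D ?i' then entry_info snd else 0)"
      by cases (simp_all add: h_def entry_info_const)
  qed simp
  also have "\<dots> = real (card (D i)) * entry_info ?add + real (card (D ?i')) * entry_info snd"
  proof -
    have "(\<Sum>uv\<in>K. if uv \<in> D c then e else 0) = real (card (D c)) * e" for c and e :: real
      using sub[of c] by (subst sum.inter_restrict[symmetric]) (simp_all add: K_def Int_absorb1)
    then show ?thesis by (simp only: sum.distrib)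
  qed
  also have "\<dots> = real (\<xi> + 1) * (real (r * l) * entry_info snd + real (r * l) * entry_info ?add) / real n"
  proof -
    \<comment> \<open>As \<open>n\<close> divides \<open>r\<close>, block heights are exact and a
      window covers precisely the fraction (\<xi> + 1) / n of all cells.\<close>
    have "real (card (D c)) = real (\<xi> + 1) * (real (r * l) / real n)" for c
      by (simp only: card of_nat_mult real_of_nat_div[OF n(3)] times_divide_eq_left times_divide_eq_right)
    then show ?thesis
      by (simp only:) (simp only: distrib_left add_divide_distrib mult.assoc mult.commute
        mult.left_commute times_divide_eq_right times_divide_eq_left add.commute)
  qed
  finally show ?thesis by (simp only: mutual_info_pad mutual_info_sum)
qed

text \<open>Decodability as injectivity: equal contents at the nodes of \<open>S\<close> force equal
  private matrices. Every block lies in the \<open>A + R\<close> window of some node of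
  \<open>S\<close> and in the \<open>R\<close> window of some node, possibly another one;
  subtracting the two shares recovers the entry.\<close>

lemma reconstruction:
  assumes n: "n > 0" "n dvd r" and \<xi>: "\<xi> < n" and S: "S \<subseteq> {..<n}" "card S = n - \<xi>"
    and \<omega>: "\<omega> \<in> space M" "\<omega>' \<in> space M"
    and eq: "\<And>i. i \<in> S \<Longrightarrow> node_content n \<xi> (A \<omega> + R \<omega>) (R \<omega>) i = node_content n \<xi> (A \<omega>' + R \<omega>') (R \<omega>') i"
  shows "A \<omega> = A \<omega>'"
proof (rule eq_matI)
  have carr: "A \<omega> \<in> carrier_mat r l" "A \<omega>' \<in> carrier_mat r l"
    using A_carrier \<omega> by auto
  then show "dim_row (A \<omega>) = dim_row (A \<omega>')" "dim_col (A \<omega>) = dim_col (A \<omega>')" by auto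
  fix u v assume "u < dim_row (A \<omega>')" "v < dim_col (A \<omega>')"
  then have uv: "u < r" "v < l" using carr by auto
  have m: "u div (r div n) < n"
    using uv(1) n by (metis dvd_mult_div_cancel less_mult_imp_div_less)
  have same: "(\<forall>uv\<in>block_cells n r l (window n \<xi> i). (A \<omega> + R \<omega>) $$ uv = (A \<omega>' + R \<omega>') $$ uv) \<and>
      (\<forall>uv\<in>block_cells n r l (window n \<xi> (n div 2 + i)). R \<omega> $$ uv = R \<omega>' $$ uv)" if "i \<in> S" for i
    using eq[OF that] node_content_eq_iff[OF sum_carrier[OF \<omega>(1)] sum_carrier[OF \<omega>(2)]
      R_carrier[OF \<omega>(1)] R_carrier[OF \<omega>(2)] n] by blast
  obtain i where "i \<in> S" "u div (r div n) \<in> window n \<xi> (0 + i)"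
    using window_cover[OF \<xi> _ m S, of 0] by auto
  then have "(A \<omega> + R \<omega>) $$ (u, v) = (A \<omega>' + R \<omega>') $$ (u, v)"
    using same uv by (auto simp: block_cells_def)
  moreover obtain i where "i \<in> S" "u div (r div n) \<in> window n \<xi> (n div 2 + i)"
    using window_cover[OF \<xi> _ m S, of "n div 2"] by auto
  then have "R \<omega> $$ (u, v) = R \<omega>' $$ (u, v)"
    using same uv by (auto simp: block_cells_def)
  ultimately show "A \<omega> $$ (u, v) = A \<omega>' $$ (u, v)"
    using sum_index \<omega> uv by simp
qed

section \<open>Storage cost and comparison with the classical scheme\<close>

lemma expectation_node_bits_shares:
  assumes s_R: "\<And>u v. u < r \<Longrightarrow> v < l \<Longrightarrow> \<P>(\<omega> in M. R \<omega> $$ (u, v) = 0) = s_R"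
    and s_AR: "\<And>u v. u < r \<Longrightarrow> v < l \<Longrightarrow> \<P>(\<omega> in M. A \<omega> $$ (u, v) + R \<omega> $$ (u, v) = 0) = s_AR"
    and n: "n > 0" "n dvd r"
  shows "expectation (\<lambda>\<omega>. node_bits (node_content n \<xi> (A \<omega> + R \<omega>) (R \<omega>) i)) =
    (2 * real \<xi> + 2) * (1 - (s_R + s_AR) / 2) * (real r * real l / real n) *
      (real_of_int \<lceil>log 2 (real q)\<rceil> + real_of_int \<lceil>log 2 (real r * real l / real n)\<rceil>)"
proof -
  have index: "(A \<omega> + R \<omega>) $$ (u, v) = A \<omega> $$ (u, v) + R \<omega> $$ (u, v)"
    if "u < r" "v < l" "\<omega> \<in> space M" for u v \<omega>
    using sum_index that by simp
  have "expectation (\<lambda>\<omega>. node_bits (node_content n \<xi> (A \<omega> + R \<omega>) (R \<omega>) i)) =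
      real (\<xi> + 1) * ((1 - s_AR) + (1 - s_R)) * real (r div n * l) *
        (real_of_int \<lceil>log 2 (real CARD('f))\<rceil> + real_of_int \<lceil>log 2 (real (r div n * l))\<rceil>)"
  proof (rule expectation_node_bits[OF sum_carrier _ _ R_carrier _ s_R n])
    fix u v assume uv: "u < r" "v < l"
    note Z = simple_function_compose1[OF entry_pair_simple[OF uv]]
    show "simple_function M (\<lambda>\<omega>. R \<omega> $$ (u, v))" using Z[of snd] by simp
    have "simple_function M (\<lambda>\<omega>. A \<omega> $$ (u, v) + R \<omega> $$ (u, v))"
      using Z[of "\<lambda>z. fst z + snd z"] by simp
    then show "simple_function M (\<lambda>\<omega>. (A \<omega> + R \<omega>) $$ (u, v))"
      by (subst simple_function_cong[OF index[OF uv]])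
    show "\<P>(\<omega> in M. (A \<omega> + R \<omega>) $$ (u, v) = 0) = s_AR"
      using s_AR[OF uv] index[OF uv] by (simp cong: conj_cong)
  qed
  moreover have "real (r div n * l) = real r * real l / real n"
    using n(2) by (simp add: real_of_nat_div)
  moreover have "real (\<xi> + 1) * ((1 - s_AR) + (1 - s_R)) = (2 * real \<xi> + 2) * (1 - (s_R + s_AR) / 2)"
    by (simp add: field_simps)
  ultimately show ?thesis by (simp only: card_field)
qed

end

text \<open>Here \<open>a\<close> stands for log 2 q, \<open>b\<close> for its ceiling and
  \<open>c\<close> for the bits of a position. With \<open>b\<close> in place of \<open>a\<close>
  the threshold would be the exact break-even point; since x / (x + c) is nondecreasing for c \<ge>
  0, the threshold with \<open>a\<close> is at least as demanding.\<close>

lemma sparse_cost_less: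
  fixes \<xi> n N a b c t :: real
  assumes "\<xi> \<ge> 0" "\<xi> + 1 < n" "N > 0" "a > 0" "a \<le> b" "c \<ge> 0"
    and t: "t > 1 - 1 / (2 * (\<xi> + 1)) * (n / (n - \<xi> - 1)) * (a / (a + c))"
  shows "(2 * \<xi> + 2) * (1 - t) * (N / n) * (b + c) < N / (n - \<xi> - 1) * b"
proof -
  have pos: "n - \<xi> - 1 > 0" "n > 0" "b + c > 0" "a + c > 0" "b > 0" using assms by linarith+
  have ratio: "a / (a + c) \<le> b / (b + c)"
    using assms pos by (simp add: divide_simps) (simp add: algebra_simps mult_right_mono)
  have "1 - t < 1 / (2 * (\<xi> + 1)) * (n / (n - \<xi> - 1)) * (a / (a + c))" using t by linarith
  also have "\<dots> \<le> 1 / (2 * (\<xi> + 1)) * (n / (n - \<xi> - 1)) * (b / (b + c))"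
    using ratio assms pos by (intro mult_left_mono) auto
  finally have "(1 - t) * ((2 * \<xi> + 2) * (N / n) * (b + c)) <
      1 / (2 * (\<xi> + 1)) * (n / (n - \<xi> - 1)) * (b / (b + c)) * ((2 * \<xi> + 2) * (N / n) * (b + c))"
    using assms pos by (intro mult_strict_right_mono) auto
  also have "\<dots> = N / (n - \<xi> - 1) * b"
  proof -
    have "1 / D * (n / E) * (b / G) * (D * (N / n) * G) = N / E * b" if "D \<noteq> 0" "G \<noteq> 0" for D E G
      using that pos(2) by simp
    from this[of "2 * (\<xi> + 1)" "b + c"] show ?thesis using assms(1) pos(3) by simp
  qed
  finally show ?thesis by (simp add: mult_ac)
qed

theorem theorem2:
  fixes M :: "'w measure"
    and A R :: "'w \<Rightarrow> 'f :: {field, finite} mat"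
    and q r l n \<xi> :: nat
    and s p1 p2 p3 p1_inv p23_inv s_R s_AR s_avg L1 L2 :: real
    and W :: "nat \<Rightarrow> 'w \<Rightarrow> 'f mat list \<times> 'f mat list"
    and EC :: "nat \<Rightarrow> real"
  assumes shares: "sparse_shares M q r l s p1 p2 p3 p1_inv p23_inv A R"
    and s_R: "\<And>u v. u < r \<Longrightarrow> v < l \<Longrightarrow> \<P>(\<omega> in M. R \<omega> $$ (u, v) = 0) = s_R"
    and s_AR: "\<And>u v. u < r \<Longrightarrow> v < l \<Longrightarrow> \<P>(\<omega> in M. A \<omega> $$ (u, v) + R \<omega> $$ (u, v) = 0) = s_AR"
    and s_avg: "s_avg = (s_R + s_AR) / 2"
    and L1: "L1 = mutual_info M (real q) A R"
    and L2: "L2 = mutual_info M (real q) A (\<lambda>\<omega>. A \<omega> + R \<omega>)"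
    and n: "n > 0" "even n" "n dvd r"
    and xi: "\<xi> \<le> n div 2 - 1"
    and W: "\<And>i \<omega>. W i \<omega> = node_content n \<xi> (A \<omega> + R \<omega>) (R \<omega>) i"
    and EC: "\<And>i. EC i = (\<integral>\<omega>. node_bits (W i \<omega>) \<partial>M)"
  shows
    "(\<forall>S. S \<subseteq> {..<n} \<and> card S = n - \<xi> \<longrightarrow>
        (\<exists>dec. \<forall>\<omega>\<in>space M. dec (\<lambda>i\<in>S. W i \<omega>) = A \<omega>))
   \<and> (\<forall>i<n. mutual_info M (real q) A (W i) = (real \<xi> + 1) * (L1 + L2) / real n)
   \<and> (\<forall>i<n. EC i \<le> (2 * real \<xi> + 2) * (1 - s_avg) * (real r * real l / real n) *
        (real_of_int \<lceil>log 2 (real q)\<rceil> + real_of_int \<lceil>log 2 (real r * real l / real n)\<rceil>))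
   \<and> (s_avg > 1 - 1 / (2 * (real \<xi> + 1)) * (real n / (real n - real \<xi> - 1)) *
          (log 2 (real q) / (log 2 (real q) + real_of_int \<lceil>log 2 (real r * real l / real n)\<rceil>))
      \<longrightarrow> (\<forall>i<n. EC i < real r * real l / (real n - real \<xi> - 1) * real_of_int \<lceil>log 2 (real q)\<rceil>))"
proof -
  interpret sparse_shares M q r l s p1 p2 p3 p1_inv p23_inv A R by (rule shares)
  have W': "W i = (\<lambda>\<omega>. node_content n \<xi> (A \<omega> + R \<omega>) (R \<omega>) i)" for i
    by (simp add: W fun_eq_iff)
  have n2: "n = 2 * (n div 2)" using n(2) by simp
  \<comment> \<open>An even positive \<open>n\<close> is at least 2, so \<xi> + 1 \<le> n / 2 < n;
    the classical denominator n - \<xi> - 1 is therefore positive.\<close>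
  then have \<xi>: "\<xi> < n" "\<xi> + 1 < n" using n(1) xi by linarith+
  have decode: "\<exists>dec. \<forall>\<omega>\<in>space M. dec (\<lambda>i\<in>S. W i \<omega>) = A \<omega>"
    if S: "S \<subseteq> {..<n}" "card S = n - \<xi>" for S
  proof -
    let ?share = "\<lambda>\<omega>. \<lambda>i\<in>S. W i \<omega>"
    \<comment> \<open>The decoder picks any sample point compatible with the contents seen; all of
      them carry the same private matrix. Restriction to \<open>S\<close> keeps the other nodes out
      of its input.\<close>
    define dec where "dec w = A (SOME \<omega>. \<omega> \<in> space M \<and> ?share \<omega> = w)" for w
    have "dec (?share \<omega>) = A \<omega>" if "\<omega> \<in> space M" for \<omega>
    proof -
      let ?\<omega>' = "SOME \<omega>'. \<omega>' \<in> space M \<and> ?share \<omega>' = ?share \<omega>"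
      have \<omega>': "?\<omega>' \<in> space M \<and> ?share ?\<omega>' = ?share \<omega>"
        by (rule someI[of _ \<omega>]) (simp add: that)
      show ?thesis
        unfolding dec_def
      proof (rule reconstruction[OF n(1,3) \<xi>(1) S conjunct1[OF \<omega>'] that])
        fix i assume "i \<in> S"
        then have "W i ?\<omega>' = W i \<omega>" using fun_cong[OF conjunct2[OF \<omega>'], of i] by simp
        then show "node_content n \<xi> (A ?\<omega>' + R ?\<omega>') (R ?\<omega>') i = node_content n \<xi> (A \<omega> + R \<omega>) (R \<omega>) i"
          by (simp only: W)
      qed
    qed
    then show ?thesis by blast
  qed
  have leak: "mutual_info M (real q) A (W i) = (real \<xi> + 1) * (L1 + L2) / real n" for i
    unfolding W' L1 L2 mutual_info_node[OF n xi] by (simp add: add.commute)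
  \<comment> \<open>The claimed upper bound is attained with equality, and the equality also feeds
    the strict comparison.\<close>
  have cost: "EC i = (2 * real \<xi> + 2) * (1 - s_avg) * (real r * real l / real n) *
      (real_of_int \<lceil>log 2 (real q)\<rceil> + real_of_int \<lceil>log 2 (real r * real l / real n)\<rceil>)" for i
    unfolding EC W s_avg by (rule expectation_node_bits_shares[OF s_R s_AR n(1,3)])
  \<comment> \<open>A sub-share has at least one entry, so its position cost is a nonnegative
    ceiling; it is 0 for a single entry.\<close>
  have "1 \<le> r div n" using n(1) dvd_imp_le[OF n(3) r_pos] by (simp add: Suc_le_eq div_greater_zero_iff)
  then have "1 * 1 \<le> real (r div n) * real l" using l_pos by (intro mult_mono) auto
  then have "0 \<le> log 2 (real r * real l / real n)"
    using n(3) by (simp add: real_of_nat_div)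
  then have "0 \<le> real_of_int \<lceil>log 2 (real r * real l / real n)\<rceil>"
    by linarith
  moreover have "0 < log 2 (real q)" "log 2 (real q) \<le> real_of_int \<lceil>log 2 (real q)\<rceil>"
    using q_ge_3 by simp_all
  moreover have "0 < real r * real l" using r_pos l_pos by simp
  ultimately have less: "EC i < real r * real l / (real n - real \<xi> - 1) * real_of_int \<lceil>log 2 (real q)\<rceil>"
    if "s_avg > 1 - 1 / (2 * (real \<xi> + 1)) * (real n / (real n - real \<xi> - 1)) *
          (log 2 (real q) / (log 2 (real q) + real_of_int \<lceil>log 2 (real r * real l / real n)\<rceil>))" for i
    unfolding cost using \<xi>(2) that
    by (intro sparse_cost_less[where a = "log 2 (real q)"]) simp_all
  show ?thesis
    using decode leak less by (intro conjI allI impI) (simp_all only: cost order.refl)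
qed

end
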